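(* Let $\mathbf S=(S,\vee,\wedge,({}^x;x\in S),1)$ be a join-semilattice whose sections are pseudocomplemented lattices, and define a binary operation $\rightarrow$ on $S$ by $x\rightarrow y:=(x\vee y)^y$ for all $x,y\in S$. Then $\mathbb I(\mathbf S):=(S,\vee,\wedge,\rightarrow,1)$ is a non-classical implication semilattice, and for all $x,y,z\in S$ it satisfies: (5) $x\leq y$ if and only if $x\rightarrow y=1$; (6) if $x\leq y$ then $y\rightarrow z\leq x\rightarrow z$; (7) $x\leq(x\rightarrow y)\rightarrow y$; (8) $\big((x\rightarrow y)\rightarrow y\big)\rightarrow y=x\rightarrow y$; (9) $1\rightarrow x=x$.
   Context: In a join-semilattice $(S,\vee,1)$ with top element $1$, the order is $x\leq y$ iff $x\vee y=y$, and $[x,1]:=\{y\in S: x\leq y\}$ (a section, i.e. principal filter). Throughout, $x\wedge y$ denotes the infimum of $x$ and $y$ in $S$, a partial operation. A pseudocomplemented lattice is a lattice $(L,\vee,\wedge)$ with bottom element $0$ and a unary operation ${}^*$ such that for every $x\in L$, $x^*$ is the greatest $y\in L$ with $x\wedge y=0$. A join-semilattice whose sections are pseudocomplemented lattices is a quintuple $(S,\vee,\wedge,({}^x;x\in S),1)$ where $(S,\vee,1)$ is a join-semilattice with top element $1$, $x\wedge y$ is defined if and only if $x$ and $y$ have a common lower bound, and for every $x\in S$, ${}^x$ is a unary operation on $[x,1]$ such that $([x,1],\vee,\wedge,{}^x)$ is a pseudocomplemented lattice (with bottom element $x$). A non-classical implication semilattice is a quintuple $(S,\vee,\wedge,\rightarrow,1)$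 where $(S,\vee,1)$ is a join-semilattice with top element $1$, the infimum $x\wedge y$ exists if and only if $x$ and $y$ have a common lower bound, and $\rightarrow$ is a binary operation on $S$ such that for all $x,y,z\in S$: (1) $y\leq x\rightarrow y$; (2) $(x\vee y)\wedge(x\rightarrow y)=y$; (3) $(x\vee y)\rightarrow y=x\rightarrow y$; (4) $y\leq(x\vee z)\rightarrow\big((x\vee z)\wedge(y\vee z)\big)$. *)

theory Defs
  imports Main "HOL-Library.Lub_Glb"
begin

text \<open>
  The carrier \<open>S\<close> is the whole type, whose class \<open>{semilattice_sup, order_top}\<close> provides the
  join-semilattice with top element \<open>1 = top\<close>. The partial infimum is an option-valued
  operation: \<open>meet x y = Some m\<close> means that the infimum of \<open>x\<close> and \<open>y\<close> in \<open>S\<close> is defined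
  and equal to \<open>m\<close>.
\<close>

locale partial_meet_semilattice =
  fixes meet :: "'a::{semilattice_sup, order_top} \<Rightarrow> 'a \<Rightarrow> 'a option"
  assumes meet_eq_Some_iff: "meet x y = Some m \<longleftrightarrow> isGlb UNIV {x, y} m"
    and meet_defined_iff: "(\<exists>m. meet x y = Some m) \<longleftrightarrow> (\<exists>w. w \<le> x \<and> w \<le> y)"

text \<open>
  The pseudocomplemented lattice \<open>(L, \<squnion>, meet, star)\<close> with bottom element \<open>b\<close>, for a subset \<open>L\<close>
  of the type. The values of \<open>star\<close> outside \<open>L\<close> are irrelevant.
\<close>

definition pseudocomplemented_lattice_on ::
  "'a::{semilattice_sup, order_top} set \<Rightarrow> ('a \<Rightarrow> 'a \<Rightarrow> 'a option) \<Rightarrow> 'a \<Rightarrow> ('a \<Rightarrow> 'a) \<Rightarrow> bool"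
  where "pseudocomplemented_lattice_on L meet b star \<longleftrightarrow>
    (\<forall>u\<in>L. \<forall>v\<in>L. isLub L {u, v} (sup u v)) \<and>
    (\<forall>u\<in>L. \<forall>v\<in>L. \<exists>m. meet u v = Some m \<and> isGlb L {u, v} m) \<and>
    b \<in> L \<and> (\<forall>u\<in>L. b \<le> u) \<and>
    (\<forall>u\<in>L. greatestP (\<lambda>v. v \<in> L \<and> meet u v = Some b) (star u))"

text \<open>
  \<open>pc x y\<close> stands for \<open>y\<^sup>x\<close>, the pseudocomplement of \<open>y\<close> in the section
  \<open>[x, 1] = {x..}\<close>; it is only meaningful for \<open>x \<le> y\<close>.
\<close>

locale sectionally_pseudocomplemented_semilattice = partial_meet_semilattice meet
  for meet :: "'a::{semilattice_sup, order_top} \<Rightarrow> 'a \<Rightarrow> 'a option" +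
  fixes pc :: "'a \<Rightarrow> 'a \<Rightarrow> 'a"
  assumes section_pseudocomplemented: "pseudocomplemented_lattice_on {x..} meet x (pc x)"

text \<open>
  An identity or inequality between terms containing the partial infimum includes the assertion
  that the infimum is defined.
\<close>

locale nonclassical_implication_semilattice = partial_meet_semilattice meet
  for meet :: "'a::{semilattice_sup, order_top} \<Rightarrow> 'a \<Rightarrow> 'a option" +
  fixes imp :: "'a \<Rightarrow> 'a \<Rightarrow> 'a"
  assumes le_imp: "y \<le> imp x y"
    and sup_meet_imp: "meet (sup x y) (imp x y) = Some y"
    and sup_imp: "imp (sup x y) y = imp x y"
    and le_sup_imp_meet: "\<exists>m. meet (sup x z) (sup y z) = Some m \<and> y \<le> imp (sup x z) m"

definition section_imp ::
  "('a::{semilattice_sup, order_top} \<Rightarrow> 'a \<Rightarrow> 'a) \<Rightarrow> 'a \<Rightarrow> 'a \<Rightarrow> 'a"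
  where "section_imp pc x y = pc y (sup x y)"

end

theory Submission
  imports Defs
begin

text \<open>
  In a section \<open>[b, 1]\<close> the pseudocomplement of \<open>u\<close> is characterised by \<open>v \<le> pc b u\<close> iff \<open>b\<close> is
  the infimum of \<open>u\<close> and \<open>v\<close>. This condition is symmetric in \<open>u\<close> and \<open>v\<close>, so \<open>pc b\<close> is an
  antitone Galois connection of the section with itself, which yields (6), (7) and (8). For (4),
  with \<open>m\<close> the infimum of \<open>x \<squnion> z\<close> and \<open>y \<squnion> z\<close>, the characterisation in \<open>[m, 1]\<close> gives
  \<open>y \<le> y \<squnion> z \<le> pc m (x \<squnion> z)\<close>.
\<close>

context partial_meet_semilattice
begin

lemma meet_eq_Some_iff_le:
  "meet x y = Some m \<longleftrightarrow> m \<le> x \<and> m \<le> y \<and> (\<forall>w. w \<le> x \<longrightarrow> w \<le> y \<longrightarrow> w \<le> m)"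
  unfolding meet_eq_Some_iff isGlb_def greatestP_def isLb_def setge_def setle_def by auto

lemma meet_commute_Some: "meet x y = Some m \<longleftrightarrow> meet y x = Some m"
  unfolding meet_eq_Some_iff_le by auto

end

context sectionally_pseudocomplemented_semilattice
begin

lemma greatestP_pc:
  assumes "b \<le> u"
  shows "greatestP (\<lambda>v. v \<in> {b..} \<and> meet u v = Some b) (pc b u)"
  using section_pseudocomplemented[of b] assms
  unfolding pseudocomplemented_lattice_on_def by simp

lemma le_pc: "b \<le> u \<Longrightarrow> b \<le> pc b u"
  using greatestP_pc[of b u] by (simp add: greatestP_def)

lemma meet_pc: "b \<le> u \<Longrightarrow> meet u (pc b u) = Some b"
  using greatestP_pc[of b u] by (simp add: greatestP_def)

text \<open>Below \<open>pc b u\<close> nothing new can meet \<open>u\<close>: a common lower bound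
  of \<open>u\<close> and \<open>v\<close> is also one of \<open>u\<close> and
  \<open>pc b u\<close>, hence lies below \<open>b\<close>. The converse is maximality of
  \<open>pc b u\<close>.\<close>

lemma le_pc_iff:
  assumes "b \<le> u" "b \<le> v"
  shows "v \<le> pc b u \<longleftrightarrow> meet u v = Some b"
proof
  assume "v \<le> pc b u"
  then show "meet u v = Some b"
    using meet_pc[OF assms(1)] assms unfolding meet_eq_Some_iff_le by (meson order_trans)
next
  assume "meet u v = Some b"
  then show "v \<le> pc b u"
    using greatestP_pc[OF assms(1)] assms(2)
    by (simp add: greatestP_def setge_def setle_def Ball_def)
qed

lemma le_pc_commute:
  assumes "b \<le> u" "b \<le> v"
  shows "v \<le> pc b u \<longleftrightarrow> u \<le> pc b v"
  using assms by (simp add: le_pc_iff meet_commute_Some)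

lemma le_pc_pc: "b \<le> u \<Longrightarrow> u \<le> pc b (pc b u)"
  using le_pc_commute[of b u "pc b u"] le_pc by blast

text \<open>By the Galois symmetry the claim amounts to \<open>u \<le> pc b (pc b v)\<close>, which
  follows from \<open>u \<le> v\<close>.\<close>

lemma pc_antimono:
  assumes "b \<le> u" "u \<le> v"
  shows "pc b v \<le> pc b u"
  using assms by (meson le_pc le_pc_commute le_pc_pc order_trans)

lemma pc_pc_pc: "b \<le> u \<Longrightarrow> pc b (pc b (pc b u)) = pc b u"
  by (intro antisym pc_antimono le_pc_pc le_pc)

text \<open>Every element is its own infimum with \<open>top\<close>.\<close>

lemma pc_top: "pc b top = b"
  using meet_pc[of b top] le_pc[of b top] by (auto simp: meet_eq_Some_iff_le intro: antisym)

lemma pc_eq_top_iff: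
  assumes "b \<le> u"
  shows "pc b u = top \<longleftrightarrow> u = b"
proof -
  have "pc b u = top \<longleftrightarrow> u \<le> pc b top"
    using le_pc_commute[of b u top] assms by (simp add: top_unique)
  then show ?thesis
    using assms by (auto simp: pc_top)
qed

text \<open>Since \<open>y \<le> pc y (sup x y)\<close>, the outer join with \<open>y\<close> is
  absorbed, so nested implications into \<open>y\<close> become iterated pseudocomplements in one
  section.\<close>

lemma section_imp_section_imp: "section_imp pc (section_imp pc x y) y = pc y (pc y (sup x y))"
  by (simp add: section_imp_def sup.absorb1 le_pc)

lemma nonclassical_implication_semilattice_section_imp:
  "nonclassical_implication_semilattice meet (section_imp pc)"
proof unfold_locales
  fix x y z
  show "y \<le> section_imp pc x y"
    and "meet (sup x y) (section_imp pc x y) = Some y"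
    and "section_imp pc (sup x y) y = section_imp pc x y"
    by (simp_all add: section_imp_def le_pc meet_pc sup.assoc)
  \<comment> \<open>The common lower bound \<open>z\<close> makes this infimum defined.\<close>
  obtain m where m: "meet (sup x z) (sup y z) = Some m"
    using meet_defined_iff[of "sup x z" "sup y z"] sup_ge2 by blast
  then have le: "m \<le> sup x z" "m \<le> sup y z"
    unfolding meet_eq_Some_iff_le by auto
  then have "sup y z \<le> pc m (sup x z)"
    using m le_pc_iff by blast
  \<comment> \<open>As \<open>m \<le> sup x z\<close>, the join inside \<open>section_imp\<close>
    collapses to \<open>sup x z\<close>.\<close>
  with le have "y \<le> section_imp pc (sup x z) m"
    by (simp add: section_imp_def sup.absorb1)
  with m show "\<exists>m. meet (sup x z) (sup y z) = Some m \<and> y \<le> section_imp pc (sup x z) m"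
    by blast
qed

lemma section_imp_eq_top_iff: "section_imp pc x y = top \<longleftrightarrow> x \<le> y"
  unfolding section_imp_def le_iff_sup[of x y] by (simp add: pc_eq_top_iff)

text \<open>Joining with \<open>z\<close> moves both arguments into the section above
  \<open>z\<close>, where \<open>pc z\<close> is antitone.\<close>

lemma section_imp_antimono: "x \<le> y \<Longrightarrow> section_imp pc y z \<le> section_imp pc x z"
  unfolding section_imp_def by (intro pc_antimono sup_mono) auto

lemma le_section_imp_section_imp: "x \<le> section_imp pc (section_imp pc x y) y"
  using le_pc_pc[of y "sup x y"] by (simp add: section_imp_section_imp)

lemma section_imp_triple:
  "section_imp pc (section_imp pc (section_imp pc x y) y) y = section_imp pc x y"
  unfolding section_imp_section_imp[of "section_imp pc x y"]
  by (simp add: section_imp_def sup.absorb1 le_pc pc_pc_pc)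

lemma section_imp_top: "section_imp pc top x = x"
  by (simp add: section_imp_def pc_top sup.absorb1)

end

theorem theorem3p4:
  fixes meet :: "'a::{semilattice_sup, order_top} \<Rightarrow> 'a \<Rightarrow> 'a option"
    and pc :: "'a \<Rightarrow> 'a \<Rightarrow> 'a"
    and imp :: "'a \<Rightarrow> 'a \<Rightarrow> 'a"
  assumes "sectionally_pseudocomplemented_semilattice meet pc"
    and "imp = section_imp pc"
  shows "nonclassical_implication_semilattice meet imp \<and>
    (\<forall>x y z.
      (x \<le> y \<longleftrightarrow> imp x y = top) \<and>
      (x \<le> y \<longrightarrow> imp y z \<le> imp x z) \<and>
      x \<le> imp (imp x y) y \<and>
      imp (imp (imp x y) y) y = imp x y \<and>
      imp top x = x)"
proof -
  interpret sectionally_pseudocomplemented_semilattice meet pc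
    by (fact assms(1))
  show ?thesis
    unfolding assms(2)
    by (simp add: nonclassical_implication_semilattice_section_imp section_imp_eq_top_iff
        section_imp_antimono le_section_imp_section_imp section_imp_triple section_imp_top)
qed

end
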